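(* For an integer $n\ge 1$, let $\mathrm{Dic}_n$ be the dicyclic group of order $4n$ with generators $a,x$, let $U$ be the uniform distribution on $\mathrm{Dic}_n$, and let $Q$ be the probability measure on $\mathrm{Dic}_n$ with $Q(a)=Q(x)=\tfrac12$. Let $Q^{*k}$ be the $k$-fold convolution of $Q$ with itself. (i) For any odd integer $n\ge 1$ and any integer $k\ge 2$, $$\| Q^{*k} - U \|_{\mathrm{TV}}^2 \le n\, 2^{-k-1} + \frac{\exp(-\pi^2(k-1)/n^2)}{2\left(1-\exp(-3 \pi^2(k-1)/n^2)\right)}.$$ (ii) For any odd integer $n\ge 7$ and any integer $k\ge 1$, $$\frac{1}{4}\exp \left( -\frac{\pi^2 k}{2n^2} - \frac{\pi^4 k}{12 n^4} - \frac{17 \pi^5 k}{120 n^5} \right) \le \| Q^{*k} - U \|_{\mathrm{TV}}.$$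
   Context: The dicyclic group $\mathrm{Dic}_n$ (of order $4n$) has presentation $\langle a, x \mid a^{2n}=1,\ x^2=a^n,\ xax^{-1}=a^{-1}\rangle$. Its $4n$ elements are $1,a,\dots,a^{2n-1},x,ax,\dots,a^{2n-1}x$, with multiplication (exponents modulo $2n$): $(a^k)(a^m)=a^{k+m}$, $(a^k)(a^mx)=a^{k+m}x$, $(a^kx)(a^m)=a^{k-m}x$, $(a^kx)(a^mx)=a^{k-m+n}$. $U(s)=1/(4n)$ for all $s\in\mathrm{Dic}_n$. Convolution powers: $Q^{*1}=Q$ and $Q^{*k}(s)=\sum_{t\in \mathrm{Dic}_n} Q(st^{-1})\,Q^{*(k-1)}(t)$ for $k\ge 2$. Total variation distance: $\|P_1-P_2\|_{\mathrm{TV}}=\max_{A\subseteq \mathrm{Dic}_n}|P_1(A)-P_2(A)|$. *)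

theory Defs
  imports Complex_Main "HOL-Algebra.Coset"
begin

text \<open>
  The dicyclic group in normal form: \<open>Rot k\<close> stands for \<open>a^k\<close> and \<open>Ref k\<close> for \<open>a^k x\<close>, with the
  exponent \<open>k\<close> normalised to \<open>{0..<2n}\<close>.
\<close>

datatype dic_elem = Rot int | Ref int

fun dic_mult :: "nat \<Rightarrow> dic_elem \<Rightarrow> dic_elem \<Rightarrow> dic_elem" where
  "dic_mult n (Rot k) (Rot m) = Rot ((k + m) mod (2 * int n))"
| "dic_mult n (Rot k) (Ref m) = Ref ((k + m) mod (2 * int n))"
| "dic_mult n (Ref k) (Rot m) = Ref ((k - m) mod (2 * int n))"
| "dic_mult n (Ref k) (Ref m) = Rot ((k - m + int n) mod (2 * int n))"

definition Dic :: "nat \<Rightarrow> dic_elem monoid" where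
  "Dic n = \<lparr>carrier = Rot ` {0..<2 * int n} \<union> Ref ` {0..<2 * int n},
            mult = dic_mult n, one = Rot 0\<rparr>"

definition dic_a :: dic_elem where "dic_a = Rot 1"
definition dic_x :: dic_elem where "dic_x = Ref 0"

text \<open>Measures on a finite group are represented by their point mass functions.\<close>

definition dic_Q :: "dic_elem \<Rightarrow> real" where
  "dic_Q s = (if s = dic_a \<or> s = dic_x then 1 / 2 else 0)"

definition dic_U :: "nat \<Rightarrow> dic_elem \<Rightarrow> real" where
  "dic_U n s = (if s \<in> carrier (Dic n) then 1 / (4 * real n) else 0)"

text \<open>The value at exponent \<open>0\<close> is the customary point mass at the identity.\<close>

fun conv_power :: "('a, 'b) monoid_scheme \<Rightarrow> ('a \<Rightarrow> real) \<Rightarrow> nat \<Rightarrow> 'a \<Rightarrow> real" where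
  "conv_power G Q 0 s = (if s = \<one>\<^bsub>G\<^esub> then 1 else 0)"
| "conv_power G Q (Suc 0) s = Q s"
| "conv_power G Q (Suc (Suc k)) s =
     (\<Sum>t\<in>carrier G. Q (s \<otimes>\<^bsub>G\<^esub> inv\<^bsub>G\<^esub> t) * conv_power G Q (Suc k) t)"

definition tv_dist :: "'a set \<Rightarrow> ('a \<Rightarrow> real) \<Rightarrow> ('a \<Rightarrow> real) \<Rightarrow> real" where
  "tv_dist S P1 P2 = Max ((\<lambda>A. \<bar>(\<Sum>s\<in>A. P1 s) - (\<Sum>s\<in>A. P2 s)\<bar>) ` Pow S)"

lemma Dic_simps [simp]:
  "mult (Dic n) = dic_mult n" "one (Dic n) = Rot 0"
  by (simp_all add: Dic_def)

lemma carrier_Dic [simp]: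
  "Rot k \<in> carrier (Dic n) \<longleftrightarrow> 0 \<le> k \<and> k < 2 * int n"
  "Ref k \<in> carrier (Dic n) \<longleftrightarrow> 0 \<le> k \<and> k < 2 * int n"
  by (auto simp: Dic_def)

lemma finite_carrier_Dic: "finite (carrier (Dic n))"
  by (simp add: Dic_def)

lemma order_Dic: "order (Dic n) = 4 * n"
proof -
  have "card (Rot ` {0..<2 * int n} \<union> Ref ` {0..<2 * int n})
      = card (Rot ` {0..<2 * int n}) + card (Ref ` {0..<2 * int n})"
    by (rule card_Un_disjoint) auto
  also have "\<dots> = 4 * n"
    by (simp add: card_image inj_on_def nat_mult_distrib)
  finally show ?thesis
    by (simp add: order_def Dic_def)
qed

lemma group_Dic:
  assumes "n \<ge> 1"
  shows "group (Dic n)"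
proof (rule groupI)
  fix s t assume "s \<in> carrier (Dic n)" "t \<in> carrier (Dic n)"
  then show "s \<otimes>\<^bsub>Dic n\<^esub> t \<in> carrier (Dic n)"
    using assms by (cases s; cases t) simp_all
next
  show "\<one>\<^bsub>Dic n\<^esub> \<in> carrier (Dic n)"
    using assms by simp
next
  fix s t u
  define N where "N = 2 * int n"
  have congs: "(k mod N + m) mod N = (k + m) mod N" "(k + m mod N) mod N = (k + m) mod N"
    "(k mod N - m) mod N = (k - m) mod N" "(k - m mod N) mod N = (k - m) mod N"
    "(k mod N - m + p) mod N = (k - m + p) mod N" "(k - m mod N + p) mod N = (k - m + p) mod N"
    for k m p
    by (rule mod_add_left_eq mod_add_right_eq mod_diff_left_eq mod_diff_right_eq)+
       (metis mod_add_left_eq mod_diff_left_eq, metis mod_add_left_eq mod_diff_right_eq)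
  have half_turn: "(k - m + int n + p) mod N = (k - (m - p + int n)) mod N" for k m p
    unfolding mod_eq_dvd_iff N_def by simp
  show "s \<otimes>\<^bsub>Dic n\<^esub> t \<otimes>\<^bsub>Dic n\<^esub> u = s \<otimes>\<^bsub>Dic n\<^esub> (t \<otimes>\<^bsub>Dic n\<^esub> u)"
    by (cases s; cases t; cases u; hypsubst; unfold Dic_simps dic_mult.simps dic_elem.inject N_def[symmetric] congs)
       (rule half_turn | (rule arg_cong[where f = "\<lambda>k. k mod N"], linarith))+
next
  fix s show "\<one>\<^bsub>Dic n\<^esub> \<otimes>\<^bsub>Dic n\<^esub> s = s" if "s \<in> carrier (Dic n)"
    using that by (cases s) simp_all
next
  fix s assume s: "s \<in> carrier (Dic n)"
  show "\<exists>t\<in>carrier (Dic n). t \<otimes>\<^bsub>Dic n\<^esub> s = \<one>\<^bsub>Dic n\<^esub>"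
  proof (cases s)
    case (Rot k)
    then show ?thesis
      using assms by (intro bexI[of _ "Rot (- k mod (2 * int n))"]) (simp_all add: mod_simps)
  next
    case (Ref k)
    have "((k + int n) mod (2 * int n) - k + int n) mod (2 * int n)
        = (k + int n - k + int n) mod (2 * int n)"
      by (metis mod_add_left_eq mod_diff_left_eq)
    also have "\<dots> = 0"
      by simp
    finally show ?thesis
      using Ref assms by (intro bexI[of _ "Ref ((k + int n) mod (2 * int n))"]) simp_all
  qed
qed

lemma Dic_pow_a:
  assumes "n \<ge> 1"
  shows "dic_a [^]\<^bsub>Dic n\<^esub> k = Rot (int k mod (2 * int n))"
proof (induction k)
  case (Suc k)
  then show ?case
    by (simp add: dic_a_def nat_pow_def mod_simps add.commute)
qed simp

lemma Dic_normal_form: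
  assumes "n \<ge> 1" "k < 2 * n"
  shows "dic_a [^]\<^bsub>Dic n\<^esub> k = Rot (int k)"
    and "dic_a [^]\<^bsub>Dic n\<^esub> k \<otimes>\<^bsub>Dic n\<^esub> dic_x = Ref (int k)"
  using assms by (simp_all add: Dic_pow_a dic_x_def)

lemma Dic_relations:
  assumes "n \<ge> 1"
  shows "dic_a [^]\<^bsub>Dic n\<^esub> (2 * n) = \<one>\<^bsub>Dic n\<^esub>"
    and "dic_x \<otimes>\<^bsub>Dic n\<^esub> dic_x = dic_a [^]\<^bsub>Dic n\<^esub> n"
    and "dic_x \<otimes>\<^bsub>Dic n\<^esub> dic_a \<otimes>\<^bsub>Dic n\<^esub> inv\<^bsub>Dic n\<^esub> dic_x = inv\<^bsub>Dic n\<^esub> dic_a"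
proof -
  interpret group "Dic n" by (rule group_Dic[OF assms])
  show "dic_a [^]\<^bsub>Dic n\<^esub> (2 * n) = \<one>\<^bsub>Dic n\<^esub>"
    and "dic_x \<otimes>\<^bsub>Dic n\<^esub> dic_x = dic_a [^]\<^bsub>Dic n\<^esub> n"
    using assms by (simp_all add: Dic_pow_a dic_x_def)
  have a: "dic_a \<in> carrier (Dic n)" and x: "dic_x \<in> carrier (Dic n)"
    using assms by (simp_all add: dic_a_def dic_x_def)
  have "- 1 mod (2 * int n) = 2 * int n - 1"
    using zmod_minus1[of "2 * int n"] assms by linarith
  then have "dic_x \<otimes>\<^bsub>Dic n\<^esub> dic_a = Rot (2 * int n - 1) \<otimes>\<^bsub>Dic n\<^esub> dic_x"
    using assms by (simp add: dic_a_def dic_x_def)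
  moreover have i: "inv\<^bsub>Dic n\<^esub> dic_a = Rot (2 * int n - 1)"
    using assms a by (intro inv_equality) (simp_all add: dic_a_def)
  ultimately show "dic_x \<otimes>\<^bsub>Dic n\<^esub> dic_a \<otimes>\<^bsub>Dic n\<^esub> inv\<^bsub>Dic n\<^esub> dic_x = inv\<^bsub>Dic n\<^esub> dic_a"
    using a x by (metis inv_solve_right inv_closed m_closed)
qed

end

theory Submission
  imports Defs "HOL-Analysis.Complex_Transcendental"
begin

text \<open>
  In the two-dimensional representation of frequency \<open>h\<close>, with \<open>w = cis (pi * h / n)\<close>, the measure
  \<open>Q\<close> acts by half the matrix with rows \<open>(w, (-1)^h)\<close> and \<open>(1, cnj w)\<close>. For odd \<open>h\<close> this is a unitary
  matrix divided by \<open>sqrt 2\<close>. For even \<open>h\<close> it has rank one and trace \<open>c = cos (pi * h / n)\<close>, so its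
  \<open>k\<close>-th power is \<open>c ^ (k - 1)\<close> times the matrix itself. The upper bound follows from Cauchy-Schwarz
  and Plancherel together with \<open>cos x \<le> exp (- x^2 / 2)\<close>; the term \<open>n * 2 powr (- k - 1)\<close> collects the
  odd frequencies. The lower bound tests \<open>Q^{*k} - U\<close> against the matrix coefficient of frequency
  \<open>n - 1\<close>, where \<open>\<bar>c\<bar> = cos (pi / n)\<close>.
\<close>

section \<open>Total variation distance and convolution\<close>

text \<open>The signed mass \<open>d\<close> has total zero, so \<open>A\<close> and its complement
  carry opposite masses and each is at most half of the L1 norm in modulus. The set \<open>B\<close>
  where \<open>d\<close> is nonnegative attains this.\<close>

lemma tv_dist_eq_half_L1:
  fixes P Q :: "'a \<Rightarrow> real"
  assumes fin: "finite S" and tot: "sum P S = sum Q S"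
  shows "tv_dist S P Q = (\<Sum>s\<in>S. \<bar>P s - Q s\<bar>) / 2"
proof -
  define d where "d s = P s - Q s" for s
  have zero: "sum d S = 0"
    by (simp add: d_def sum_subtractf tot)
  have diff: "sum P A - sum Q A = sum d A" for A
    by (simp add: d_def sum_subtractf)
  have split: "sum d A + sum d (S - A) = 0" "(\<Sum>s\<in>A. \<bar>d s\<bar>) + (\<Sum>s\<in>S - A. \<bar>d s\<bar>) = (\<Sum>s\<in>S. \<bar>d s\<bar>)"
    if "A \<subseteq> S" for A
    using that fin zero sum.subset_diff[of A S d] sum.subset_diff[of A S "\<lambda>s. \<bar>d s\<bar>"] by simp_all
  have le: "\<bar>sum d A\<bar> \<le> (\<Sum>s\<in>S. \<bar>d s\<bar>) / 2" if "A \<subseteq> S" for A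
    using split[OF that] sum_abs[of d A] sum_abs[of d "S - A"] by linarith
  define B where "B = {s \<in> S. d s \<ge> 0}"
  have B: "B \<subseteq> S"
    by (auto simp: B_def)
  have "(\<Sum>s\<in>B. \<bar>d s\<bar>) = sum d B"
    by (intro sum.cong) (auto simp: B_def)
  moreover have "(\<Sum>s\<in>S - B. \<bar>d s\<bar>) = - sum d (S - B)"
    unfolding sum_negf[symmetric] by (intro sum.cong) (auto simp: B_def)
  ultimately have eq: "(\<Sum>s\<in>S. \<bar>d s\<bar>) / 2 = \<bar>sum d B\<bar>"
    using split[OF B] sum_nonneg[of B "\<lambda>s. \<bar>d s\<bar>"] by simp
  have "Max ((\<lambda>A. \<bar>sum d A\<bar>) ` Pow S) = (\<Sum>s\<in>S. \<bar>d s\<bar>) / 2"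
  proof (rule Max_eqI)
    show "finite ((\<lambda>A. \<bar>sum d A\<bar>) ` Pow S)"
      using fin by simp
    show "y \<le> (\<Sum>s\<in>S. \<bar>d s\<bar>) / 2" if "y \<in> (\<lambda>A. \<bar>sum d A\<bar>) ` Pow S" for y
      using that le by auto
    show "(\<Sum>s\<in>S. \<bar>d s\<bar>) / 2 \<in> (\<lambda>A. \<bar>sum d A\<bar>) ` Pow S"
      unfolding eq using B by blast
  qed
  then show ?thesis
    by (simp add: tv_dist_def diff d_def)
qed

text \<open>Transposes convolution by \<open>Q\<close>: via \<open>u = s \<otimes> inv t\<close>,
  pairing with \<open>\<phi>\<close> becomes averaging left translates of \<open>\<phi>\<close>
  under \<open>Q\<close>. This is how one more step acts on Fourier coefficients.\<close>

lemma (in group) sum_convolution: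
  fixes Q f \<phi> :: "'a \<Rightarrow> 'c :: comm_semiring_0"
  shows "(\<Sum>s\<in>carrier G. (\<Sum>t\<in>carrier G. Q (s \<otimes> inv t) * f t) * \<phi> s)
    = (\<Sum>t\<in>carrier G. f t * (\<Sum>u\<in>carrier G. Q u * \<phi> (u \<otimes> t)))"
proof -
  have "(\<Sum>s\<in>carrier G. Q (s \<otimes> inv t) * \<phi> s) = (\<Sum>u\<in>carrier G. Q u * \<phi> (u \<otimes> t))"
    if "t \<in> carrier G" for t
    by (rule sum.reindex_bij_witness[where i = "\<lambda>u. u \<otimes> t" and j = "\<lambda>s. s \<otimes> inv t"])
       (use that in \<open>simp_all add: m_assoc\<close>)
  moreover have "(\<Sum>s\<in>carrier G. (\<Sum>t\<in>carrier G. Q (s \<otimes> inv t) * f t) * \<phi> s)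
    = (\<Sum>t\<in>carrier G. f t * (\<Sum>s\<in>carrier G. Q (s \<otimes> inv t) * \<phi> s))"
    unfolding sum_distrib_left sum_distrib_right
    by (subst sum.swap) (simp add: mult_ac)
  ultimately show ?thesis
    by simp
qed

lemma sum_carrier_Dic:
  "(\<Sum>s\<in>carrier (Dic n). g s)
    = (\<Sum>j\<in>{0..<2 * int n}. g (Rot j)) + (\<Sum>j\<in>{0..<2 * int n}. g (Ref j))"
proof -
  have "(\<Sum>s\<in>carrier (Dic n). g s)
      = (\<Sum>s\<in>Rot ` {0..<2 * int n}. g s) + (\<Sum>s\<in>Ref ` {0..<2 * int n}. g s)"
    unfolding Dic_def by (simp, rule sum.union_disjoint) auto
  then show ?thesis
    by (simp add: sum.reindex inj_on_def)
qed

lemma sum_dic_Q: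
  fixes \<psi> :: "dic_elem \<Rightarrow> complex"
  assumes "n \<ge> 1"
  shows "(\<Sum>u\<in>carrier (Dic n). of_real (dic_Q u) * \<psi> u) = (\<psi> dic_a + \<psi> dic_x) / 2"
proof -
  have "(\<Sum>u\<in>carrier (Dic n). of_real (dic_Q u) * \<psi> u)
      = (\<Sum>u\<in>{dic_a, dic_x}. of_real (dic_Q u) * \<psi> u)"
    using assms by (intro sum.mono_neutral_right finite_carrier_Dic)
      (auto simp: dic_Q_def dic_a_def dic_x_def)
  then show ?thesis
    by (simp add: dic_Q_def dic_a_def dic_x_def add_divide_distrib)
qed

section \<open>Fourier analysis on the dicyclic group\<close>

definition unit_root :: "nat \<Rightarrow> int \<Rightarrow> complex" where
  "unit_root n m = cis (pi * of_int m / of_nat n)"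

text \<open>The two functions below span a column of matrix coefficients of the two-dimensional
  representation of frequency \<open>h\<close>. With the minus sign in the second one, left translation by
  \<open>x\<close> exchanges the two up to sign.\<close>

fun rot_char :: "nat \<Rightarrow> int \<Rightarrow> dic_elem \<Rightarrow> complex" where
  "rot_char n h (Rot j) = unit_root n (h * j)"
| "rot_char n h (Ref j) = 0"

fun ref_char :: "nat \<Rightarrow> int \<Rightarrow> dic_elem \<Rightarrow> complex" where
  "ref_char n h (Rot j) = 0"
| "ref_char n h (Ref j) = unit_root n (- h * j)"

lemma unit_root_add: "unit_root n (l + m) = unit_root n l * unit_root n m"
  by (simp add: unit_root_def cis_mult add_divide_distrib ring_distribs)

lemma unit_root_0 [simp]: "unit_root n 0 = 1"
  by (simp add: unit_root_def)

lemma norm_unit_root [simp]: "cmod (unit_root n m) = 1"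
  by (simp add: unit_root_def)

lemma cnj_unit_root: "cnj (unit_root n m) = unit_root n (- m)"
  by (simp add: unit_root_def cis_cnj)

lemma unit_root_power: "unit_root n m ^ k = unit_root n (int k * m)"
  by (simp add: unit_root_def Complex.DeMoivre mult_ac)

lemma unit_root_n_mult:
  assumes "n \<ge> 1"
  shows "unit_root n (int n * m) = (if even m then 1 else -1)"
proof -
  have "unit_root n (int n * m) = cis (pi * of_int m)"
    using assms by (simp add: unit_root_def)
  then show ?thesis
    by (simp add: complex_eq_iff mult.commute)
qed

text \<open>Makes the reduction of exponents in \<open>dic_mult\<close> invisible to the
  characters.\<close>

lemma unit_root_period:
  assumes "n \<ge> 1"
  shows "unit_root n (h * (m mod (2 * int n))) = unit_root n (h * m)"
proof -
  have "h * m = h * (m mod (2 * int n)) + int n * (2 * (h * (m div (2 * int n))))"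
    by (metis (no_types, opaque_lifting) mult_div_mod_eq add.commute distrib_left mult.assoc mult.left_commute)
  then show ?thesis
    using assms by (simp only: unit_root_add unit_root_n_mult) simp
qed

lemma unit_root_eq_1_iff:
  assumes "n \<ge> 1"
  shows "unit_root n d = 1 \<longleftrightarrow> 2 * int n dvd d"
proof
  assume "unit_root n d = 1"
  then have "cos (pi * of_int d / of_nat n) = 1"
    by (simp add: unit_root_def complex_eq_iff)
  then obtain m where "pi * of_int d / of_nat n = of_int m * 2 * pi"
    by (auto simp: cos_one_2pi_int)
  then have "real_of_int d = of_int (2 * int n * m)"
    using assms by (simp add: field_simps)
  then show "2 * int n dvd d"
    by (metis dvd_triv_left of_int_eq_iff)
next
  assume "2 * int n dvd d"
  then show "unit_root n d = 1"
    using unit_root_n_mult[OF assms] by (auto simp: dvd_def mult.assoc mult.left_commute)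
qed

section \<open>Orthogonality of characters and the Plancherel identity\<close>

lemma sum_unit_root:
  assumes "n \<ge> 1"
  shows "(\<Sum>h<2 * n. unit_root n (int h * d)) = (if 2 * int n dvd d then 2 * of_nat n else 0)"
proof (cases "2 * int n dvd d")
  case True
  then have "unit_root n (int h * d) = 1" for h
    using unit_root_eq_1_iff[OF assms] by simp
  then show ?thesis
    using True by simp
next
  case False
  then have "unit_root n d \<noteq> 1"
    using unit_root_eq_1_iff[OF assms] by simp
  moreover have "unit_root n d ^ (2 * n) = 1"
    using unit_root_eq_1_iff[OF assms] by (simp add: unit_root_power del: power_mult)
  ultimately have "(\<Sum>h<2 * n. unit_root n d ^ h) = 0"
    by (simp add: geometric_sum)
  then show ?thesis
    using False by (simp add: unit_root_power)
qed

text \<open>After the squared modulus is expanded, the sum over frequencies is taken first and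
  orthogonality leaves only the diagonal.\<close>

lemma Plancherel_cyclic:
  fixes f :: "int \<Rightarrow> real"
  assumes "n \<ge> 1"
  shows "(\<Sum>h<2 * n. (cmod (\<Sum>j\<in>{0..<2 * int n}. of_real (f j) * unit_root n (int h * j)))\<^sup>2)
    = 2 * real n * (\<Sum>j\<in>{0..<2 * int n}. (f j)\<^sup>2)"
proof -
  let ?I = "{0..<2 * int n}"
  have sq: "complex_of_real ((cmod (\<Sum>j\<in>?I. of_real (f j) * unit_root n (h * j)))\<^sup>2)
      = (\<Sum>j\<in>?I. \<Sum>l\<in>?I. of_real (f j * f l) * unit_root n (h * (j - l)))" for h
  proof -
    have "unit_root n (h * (j - l)) = unit_root n (h * j) * cnj (unit_root n (h * l))" for j l
      by (simp add: cnj_unit_root flip: unit_root_add) (simp add: algebra_simps)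
    then show ?thesis
      unfolding complex_norm_square by (simp add: sum_product mult_ac)
  qed
  have delta: "(2 * int n dvd j - l) \<longleftrightarrow> j = l" if "j \<in> ?I" "l \<in> ?I" for j l
    using that zdvd_imp_le[of "2 * int n" "j - l"] zdvd_imp_le[of "2 * int n" "l - j"]
      dvd_diff_commute[of "2 * int n" j l] by fastforce
  have "complex_of_real (\<Sum>h<2 * n. (cmod (\<Sum>j\<in>?I. of_real (f j) * unit_root n (int h * j)))\<^sup>2)
      = (\<Sum>h<2 * n. \<Sum>j\<in>?I. \<Sum>l\<in>?I. of_real (f j * f l) * unit_root n (int h * (j - l)))"
    unfolding of_real_sum sq ..
  also have "\<dots> = (\<Sum>j\<in>?I. \<Sum>l\<in>?I. \<Sum>h<2 * n. of_real (f j * f l) * unit_root n (int h * (j - l)))"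
    by (subst sum.swap, intro sum.cong refl sum.swap)
  also have "\<dots> = (\<Sum>j\<in>?I. \<Sum>l\<in>?I. if j = l then 2 * of_nat n * of_real ((f j)\<^sup>2) else 0)"
    using sum_unit_root[OF assms] delta
    by (intro sum.cong refl) (simp add: power2_eq_square flip: sum_distrib_left)
  also have "\<dots> = complex_of_real (2 * real n * (\<Sum>j\<in>?I. (f j)\<^sup>2))"
    by (simp add: sum_distrib_left)
  finally show ?thesis
    unfolding of_real_eq_iff .
qed

definition fourier :: "nat \<Rightarrow> (dic_elem \<Rightarrow> complex) \<Rightarrow> (dic_elem \<Rightarrow> real) \<Rightarrow> complex" where
  "fourier n \<phi> f = (\<Sum>s\<in>carrier (Dic n). of_real (f s) * \<phi> s)"

text \<open>Rotations and reflections form two copies of the cyclic index set, each with its own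
  Plancherel identity. Running over all \<open>2 * n\<close> frequencies meets each irreducible
  two-dimensional representation twice, at \<open>h\<close> and \<open>2 * n - h\<close>.\<close>

lemma Plancherel_Dic:
  assumes "n \<ge> 1"
  shows "(\<Sum>h<2 * n. (cmod (fourier n (rot_char n (int h)) f))\<^sup>2
      + (cmod (fourier n (ref_char n (int h)) f))\<^sup>2)
    = 2 * real n * (\<Sum>s\<in>carrier (Dic n). (f s)\<^sup>2)"
proof -
  have rot: "fourier n (rot_char n h) f
      = (\<Sum>j\<in>{0..<2 * int n}. of_real (f (Rot j)) * unit_root n (h * j))" for h
    by (simp add: fourier_def sum_carrier_Dic)
  \<comment> \<open>As \<open>f\<close> is real, the minus sign in \<open>ref_char\<close> only
    conjugates the coefficient.\<close>
  have "fourier n (ref_char n h) f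
      = cnj (\<Sum>j\<in>{0..<2 * int n}. of_real (f (Ref j)) * unit_root n (h * j))" for h
    by (simp add: fourier_def sum_carrier_Dic cnj_unit_root)
  then have ref: "cmod (fourier n (ref_char n h) f)
      = cmod (\<Sum>j\<in>{0..<2 * int n}. of_real (f (Ref j)) * unit_root n (h * j))" for h
    by (metis complex_mod_cnj)
  show ?thesis
    unfolding rot ref sum.distrib Plancherel_cyclic[OF assms] sum_carrier_Dic
    by (simp add: distrib_left)
qed

text \<open>The sign reflects \<open>x^2 = a^n\<close>: left multiplication by \<open>x\<close>
  takes \<open>Ref j\<close> to a rotation with exponent \<open>n - j\<close>, and
  \<open>unit_root n (n * h)\<close> equals \<open>(-1)^h\<close>.\<close>

lemma rot_char_translate:
  assumes "n \<ge> 1"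
  shows "rot_char n h (dic_mult n dic_a s) = unit_root n h * rot_char n h s"
    and "rot_char n h (dic_mult n dic_x s) = (if even h then 1 else -1) * ref_char n h s"
proof -
  show "rot_char n h (dic_mult n dic_a s) = unit_root n h * rot_char n h s"
    by (cases s) (simp_all add: dic_a_def unit_root_period[OF assms] unit_root_add distrib_left)
  have "unit_root n (h * (int n - j)) = (if even h then 1 else -1) * unit_root n (- h * j)" for j
  proof -
    have "h * (int n - j) = int n * h + - h * j"
      by (simp add: algebra_simps)
    then show ?thesis
      by (simp only: unit_root_add unit_root_n_mult[OF assms])
  qed
  then show "rot_char n h (dic_mult n dic_x s) = (if even h then 1 else -1) * ref_char n h s"
    by (cases s) (simp_all add: dic_x_def unit_root_period[OF assms])
qed

lemma ref_char_translate:
  assumes "n \<ge> 1"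
  shows "ref_char n h (dic_mult n dic_a s) = cnj (unit_root n h) * ref_char n h s"
    and "ref_char n h (dic_mult n dic_x s) = rot_char n h s"
proof -
  have per: "unit_root n (- (h * (m mod (2 * int n)))) = unit_root n (- (h * m))" for m
    using unit_root_period[OF assms, of "- h" m] by simp
  have "unit_root n (- (h * (1 + j))) = unit_root n (- h) * unit_root n (- (h * j))" for j
    by (simp add: distrib_left flip: unit_root_add)
  then show "ref_char n h (dic_mult n dic_a s) = cnj (unit_root n h) * ref_char n h s"
    by (cases s) (simp_all add: dic_a_def per cnj_unit_root)
  show "ref_char n h (dic_mult n dic_x s) = rot_char n h s"
    by (cases s) (simp_all add: dic_x_def per)
qed

section \<open>Fourier coefficients of the convolution powers\<close>

lemma fourier_conv_power_1:
  assumes "n \<ge> 1"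
  shows "fourier n (rot_char n h) (conv_power (Dic n) dic_Q (Suc 0)) = unit_root n h / 2"
    and "fourier n (ref_char n h) (conv_power (Dic n) dic_Q (Suc 0)) = 1 / 2"
  by (simp_all add: fourier_def sum_dic_Q[OF assms]) (simp_all add: dic_a_def dic_x_def)

lemma fourier_conv_power_Suc:
  assumes "n \<ge> 1"
  shows "fourier n \<phi> (conv_power (Dic n) dic_Q (Suc (Suc k)))
    = (\<Sum>t\<in>carrier (Dic n). of_real (conv_power (Dic n) dic_Q (Suc k) t)
        * ((\<phi> (dic_mult n dic_a t) + \<phi> (dic_mult n dic_x t)) / 2))"
proof -
  interpret group "Dic n" by (rule group_Dic[OF assms])
  show ?thesis
    using sum_convolution[of "\<lambda>s. of_real (dic_Q s)" "\<lambda>s. of_real (conv_power (Dic n) dic_Q (Suc k) s)" \<phi>]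
    by (simp add: fourier_def sum_dic_Q[OF assms])
qed

text \<open>The span of \<open>rot_char n h\<close> and \<open>ref_char n h\<close> is stable under
  left translation by both generators, so a convolution step acts on the pair \<open>(F, G)\<close>
  by a fixed 2 by 2 matrix.\<close>

lemma fourier_rec:
  assumes "n \<ge> 1"
  defines "F \<equiv> \<lambda>h k. fourier n (rot_char n h) (conv_power (Dic n) dic_Q k)"
    and "G \<equiv> \<lambda>h k. fourier n (ref_char n h) (conv_power (Dic n) dic_Q k)"
  shows "F h (Suc (Suc k)) = (unit_root n h * F h (Suc k) + (if even h then 1 else -1) * G h (Suc k)) / 2"
    and "G h (Suc (Suc k)) = (cnj (unit_root n h) * G h (Suc k) + F h (Suc k)) / 2"
  unfolding F_def G_def fourier_conv_power_Suc[OF assms(1)] rot_char_translate[OF assms(1)]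
    ref_char_translate[OF assms(1)] unfolding fourier_def
  by (simp_all add: sum_distrib_left flip: sum_divide_distrib sum.distrib sum_negf sum_subtractf)
    (simp_all add: algebra_simps)

text \<open>The first step puts the pair at \<open>(w, 1) / 2\<close> with
  \<open>w = unit_root n h\<close>. This is an eigenvector of the transition matrix with eigenvalue
  the cosine \<open>c\<close>, because \<open>w * w + 1 = w * (w + cnj w)\<close>; hence only
  \<open>k\<close> powers after \<open>Suc k\<close> steps.\<close>

lemma fourier_even:
  assumes "n \<ge> 1" "even h"
  shows "fourier n (rot_char n h) (conv_power (Dic n) dic_Q (Suc k))
      = unit_root n h * of_real (cos (pi * of_int h / of_nat n)) ^ k / 2" (is "?F k = _")
    and "fourier n (ref_char n h) (conv_power (Dic n) dic_Q (Suc k))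
      = of_real (cos (pi * of_int h / of_nat n)) ^ k / 2" (is "?G k = _")
proof -
  define c :: complex where "c = of_real (cos (pi * of_int h / of_nat n))"
  have c: "unit_root n h + cnj (unit_root n h) = 2 * c"
    by (simp add: c_def unit_root_def complex_eq_iff)
  have unit: "unit_root n h * cnj (unit_root n h) = 1"
    by (simp add: cnj_unit_root flip: unit_root_add)
  have "?F k = unit_root n h * c ^ k / 2 \<and> ?G k = c ^ k / 2"
  proof (induction k)
    case 0
    then show ?case
      unfolding fourier_conv_power_1[OF assms(1)] by simp
  next
    case (Suc k)
    have "?F (Suc k) = (unit_root n h * (unit_root n h * c ^ k / 2) + c ^ k / 2) / 2"
      using Suc assms(2) unfolding fourier_rec[OF assms(1)] by simp
    also have "\<dots> = unit_root n h * (unit_root n h + cnj (unit_root n h)) * c ^ k / 4"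
      using unit by (simp add: algebra_simps)
    also have "\<dots> = unit_root n h * c ^ Suc k / 2"
      unfolding c by simp
    finally have F: "?F (Suc k) = unit_root n h * c ^ Suc k / 2" .
    have "?G (Suc k) = (cnj (unit_root n h) * (c ^ k / 2) + unit_root n h * c ^ k / 2) / 2"
      using Suc unfolding fourier_rec[OF assms(1)] by simp
    also have "\<dots> = (unit_root n h + cnj (unit_root n h)) * c ^ k / 4"
      by (simp add: algebra_simps)
    also have "\<dots> = c ^ Suc k / 2"
      unfolding c by simp
    finally show ?case
      using F by simp
  qed
  then show "?F k = unit_root n h * of_real (cos (pi * of_int h / of_nat n)) ^ k / 2"
    and "?G k = of_real (cos (pi * of_int h / of_nat n)) ^ k / 2"
    by (simp_all add: c_def)
qed

text \<open>At odd frequencies the transition matrix is unitary up to the factor \<open>1 / sqrt 2\<close>.\<close>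

lemma norm_twisted_rotation:
  assumes "cmod w = 1"
  shows "(cmod (w * z - y))\<^sup>2 + (cmod (cnj w * y + z))\<^sup>2 = 2 * ((cmod z)\<^sup>2 + (cmod y)\<^sup>2)"
proof -
  have w: "w * cnj w = 1"
    using assms by (simp add: complex_norm_square[symmetric])
  have "complex_of_real ((cmod (w * z - y))\<^sup>2 + (cmod (cnj w * y + z))\<^sup>2)
      = (w * z - y) * (cnj w * cnj z - cnj y) + (cnj w * y + z) * (w * cnj y + cnj z)"
    unfolding of_real_add complex_norm_square by simp
  also have "\<dots> = (w * cnj w + 1) * (z * cnj z + y * cnj y)"
    by (simp add: algebra_simps)
  also have "\<dots> = complex_of_real (2 * ((cmod z)\<^sup>2 + (cmod y)\<^sup>2))"
    unfolding w of_real_mult of_real_add complex_norm_square by simp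
  finally show ?thesis
    unfolding of_real_eq_iff .
qed

text \<open>The sum starts at \<open>1 / 4 + 1 / 4\<close> and halves at each step: the factor
  \<open>2\<close> of \<open>norm_twisted_rotation\<close> is divided by \<open>4\<close>.\<close>

lemma fourier_odd:
  assumes "n \<ge> 1" "odd h"
  shows "(cmod (fourier n (rot_char n h) (conv_power (Dic n) dic_Q (Suc k))))\<^sup>2
    + (cmod (fourier n (ref_char n h) (conv_power (Dic n) dic_Q (Suc k))))\<^sup>2 = (1 / 2) ^ Suc k"
proof (induction k)
  case 0
  then show ?case
    unfolding fourier_conv_power_1[OF assms(1)] by (simp add: norm_divide power_divide)
next
  case (Suc k)
  then show ?case
    unfolding fourier_rec[OF assms(1)]
    using assms(2) norm_twisted_rotation[OF norm_unit_root]
    by (simp add: norm_divide power_divide flip: add_divide_distrib)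
qed

text \<open>At frequency zero the two coefficient functions are the indicators of rotations and
  reflections, so the total mass is a sum of two known coefficients.\<close>

lemma conv_power_total:
  assumes "n \<ge> 1"
  shows "(\<Sum>s\<in>carrier (Dic n). conv_power (Dic n) dic_Q (Suc k) s) = 1"
proof -
  have "rot_char n 0 s + ref_char n 0 s = 1" for s
    by (cases s) simp_all
  then have "complex_of_real (\<Sum>s\<in>carrier (Dic n). conv_power (Dic n) dic_Q (Suc k) s)
      = fourier n (rot_char n 0) (conv_power (Dic n) dic_Q (Suc k))
      + fourier n (ref_char n 0) (conv_power (Dic n) dic_Q (Suc k))"
    unfolding fourier_def by (simp flip: sum.distrib distrib_left)
  also have "\<dots> = 1"
    by (simp add: fourier_even[OF assms] del: conv_power.simps)
  finally show ?thesis
    by (simp only: of_real_eq_1_iff)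
qed

lemma dic_U_total:
  assumes "n \<ge> 1"
  shows "(\<Sum>s\<in>carrier (Dic n). dic_U n s) = 1"
  using assms order_Dic[of n] by (simp add: dic_U_def order_def)

lemma sum_even_odd: "(\<Sum>h<2 * n. g h) = (\<Sum>l<n. g (2 * l) + g (2 * l + 1))"
  for g :: "nat \<Rightarrow> 'a :: comm_monoid_add"
  by (induction n) (simp_all add: ac_simps)

section \<open>Bounds on the total variation distance\<close>

text \<open>In Plancherel each of the \<open>n\<close> odd frequencies contributes
  \<open>(1 / 2) ^ Suc k\<close> and the even frequency \<open>2 * l\<close> contributes
  \<open>c l / 2\<close>. Subtracting \<open>dic_U\<close> removes exactly the term at
  \<open>l = 0\<close>.\<close>

lemma conv_power_L2_dist:
  assumes "n \<ge> 1"
  shows "4 * real n * (\<Sum>s\<in>carrier (Dic n). (conv_power (Dic n) dic_Q (Suc k) s - dic_U n s)\<^sup>2)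
    = real n / 2 ^ k + (\<Sum>l\<in>{1..<n}. cos (2 * pi * real l / real n) ^ (2 * k))"
proof -
  let ?S = "carrier (Dic n)"
  define f where "f = conv_power (Dic n) dic_Q (Suc k)"
  define c where "c l = cos (2 * pi * real l / real n) ^ (2 * k)" for l :: nat
  have even: "(cmod (fourier n (rot_char n (2 * int l)) f))\<^sup>2
      + (cmod (fourier n (ref_char n (2 * int l)) f))\<^sup>2 = c l / 2" for l
  proof -
    have "(cmod (of_real r :: complex) ^ k)\<^sup>2 = r ^ (2 * k)" for r
      by (simp add: power_even_abs flip: power_mult) (simp add: mult.commute power_even_abs)
    then show ?thesis
      using assms unfolding f_def
      by (simp add: fourier_even norm_divide norm_mult norm_power power_divide c_def mult_ac
          del: conv_power.simps norm_of_real)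
  qed
  have odd: "(cmod (fourier n (rot_char n (2 * int l + 1)) f))\<^sup>2
      + (cmod (fourier n (ref_char n (2 * int l + 1)) f))\<^sup>2 = (1 / 2) ^ Suc k" for l
    unfolding f_def using assms by (intro fourier_odd) simp_all
  have "2 * real n * (\<Sum>s\<in>?S. (f s)\<^sup>2) = (\<Sum>l<n. c l / 2 + (1 / 2) ^ Suc k)"
    unfolding Plancherel_Dic[OF assms, symmetric] sum_even_odd
    by (simp only: of_nat_mult of_nat_add of_nat_numeral of_nat_1 even odd)
  also have "\<dots> = (\<Sum>l<n. c l) / 2 + real n / 2 ^ Suc k"
    by (simp add: sum.distrib sum_divide_distrib power_divide)
  finally have sq: "4 * real n * (\<Sum>s\<in>?S. (f s)\<^sup>2) = (\<Sum>l<n. c l) + real n / 2 ^ k"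
    by simp
  have "(\<Sum>l<n. c l) = 1 + (\<Sum>l\<in>{1..<n}. c l)"
    using assms sum.atLeast_Suc_lessThan[of 0 n c] by (simp add: atLeast0LessThan c_def)
  moreover have "4 * real n * (\<Sum>s\<in>?S. (f s - dic_U n s)\<^sup>2)
      = 4 * real n * (\<Sum>s\<in>?S. (f s)\<^sup>2) - 1"
  proof -
    \<comment> \<open>On \<open>?S\<close> the uniform mass is the constant
      \<open>1 / (4 * n)\<close>; both correction terms are thus multiples of total masses equal to
      \<open>1\<close>.\<close>
    have "(\<Sum>s\<in>?S. (f s - dic_U n s)\<^sup>2)
        = (\<Sum>s\<in>?S. (f s)\<^sup>2 - f s / (2 * real n) + dic_U n s / (4 * real n))"
      using assms by (intro sum.cong refl) (simp add: dic_U_def power2_eq_square field_simps)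
    also have "\<dots> = (\<Sum>s\<in>?S. (f s)\<^sup>2) - 1 / (2 * real n) + 1 / (4 * real n)"
      using conv_power_total[OF assms, of k] dic_U_total[OF assms]
      by (simp add: f_def sum.distrib sum_subtractf flip: sum_divide_distrib del: conv_power.simps)
    finally show ?thesis
      using assms by (simp add: field_simps)
  qed
  ultimately show ?thesis
    using sq by (simp add: f_def c_def del: conv_power.simps)
qed

text \<open>Cauchy-Schwarz against the constant \<open>1\<close> costs the group order
  \<open>4 * n\<close>, and squaring the half L1 norm gives the factor \<open>1 / 4\<close>.\<close>

lemma tv_dist_upper:
  assumes "n \<ge> 1"
  shows "(tv_dist (carrier (Dic n)) (conv_power (Dic n) dic_Q (Suc k)) (dic_U n))\<^sup>2
    \<le> real n / 2 ^ (k + 2) + (\<Sum>l\<in>{1..<n}. cos (2 * pi * real l / real n) ^ (2 * k)) / 4"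
proof -
  let ?S = "carrier (Dic n)"
  define d where "d s = \<bar>conv_power (Dic n) dic_Q (Suc k) s - dic_U n s\<bar>" for s
  have "(\<Sum>s\<in>?S. d s)\<^sup>2 \<le> 4 * real n * (\<Sum>s\<in>?S. (d s)\<^sup>2)"
    using Cauchy_Schwarz_ineq_sum[of d "\<lambda>_. 1" ?S] order_Dic[of n]
    by (simp add: order_def mult.commute)
  also have "\<dots> = real n / 2 ^ k + (\<Sum>l\<in>{1..<n}. cos (2 * pi * real l / real n) ^ (2 * k))"
    using conv_power_L2_dist[OF assms, of k] by (simp add: d_def del: conv_power.simps)
  finally have "(\<Sum>s\<in>?S. d s)\<^sup>2 / 4
      \<le> (real n / 2 ^ k + (\<Sum>l\<in>{1..<n}. cos (2 * pi * real l / real n) ^ (2 * k))) / 4"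
    by simp
  moreover have tv: "tv_dist ?S (conv_power (Dic n) dic_Q (Suc k)) (dic_U n) = (\<Sum>s\<in>?S. d s) / 2"
    unfolding d_def using conv_power_total[OF assms] dic_U_total[OF assms]
    by (intro tv_dist_eq_half_L1 finite_carrier_Dic) simp
  ultimately show ?thesis
    unfolding tv by (simp add: power_divide add_divide_distrib)
qed

text \<open>The test function \<open>rot_char n h\<close> has modulus at most \<open>1\<close> and
  sums to zero, so its coefficient at \<open>f\<close> bounds the L1 norm from below. One half comes
  from that coefficient, the other from halving the L1 norm.\<close>

lemma tv_dist_lower:
  assumes "n \<ge> 1" "even h" "\<not> 2 * int n dvd h"
  shows "\<bar>cos (pi * of_int h / real n)\<bar> ^ k / 4
    \<le> tv_dist (carrier (Dic n)) (conv_power (Dic n) dic_Q (Suc k)) (dic_U n)"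
proof -
  let ?S = "carrier (Dic n)"
  define f where "f = conv_power (Dic n) dic_Q (Suc k)"
  have "(\<Sum>j\<in>{0..<2 * int n}. unit_root n (h * j)) = (\<Sum>j<2 * n. unit_root n (int j * h))"
    by (rule sum.reindex_bij_witness[where i = int and j = nat]) (auto simp: mult.commute)
  then have "fourier n (rot_char n h) (dic_U n) = 0"
    using sum_unit_root[OF assms(1)] assms(3)
    by (simp add: fourier_def sum_carrier_Dic dic_U_def flip: sum_divide_distrib)
  then have "fourier n (rot_char n h) f = (\<Sum>s\<in>?S. of_real (f s - dic_U n s) * rot_char n h s)"
    by (simp add: fourier_def left_diff_distrib sum_subtractf)
  also have "cmod \<dots> \<le> (\<Sum>s\<in>?S. \<bar>f s - dic_U n s\<bar>)"
  proof (rule sum_norm_le)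
    fix s
    have "cmod (rot_char n h s) \<le> 1"
      by (cases s) simp_all
    then show "cmod (of_real (f s - dic_U n s) * rot_char n h s) \<le> \<bar>f s - dic_U n s\<bar>"
      unfolding norm_mult norm_of_real by (simp add: mult_left_le)
  qed
  also have "cmod (fourier n (rot_char n h) f) = \<bar>cos (pi * of_int h / real n)\<bar> ^ k / 2"
    unfolding f_def fourier_even[OF assms(1,2)] by (simp add: norm_divide norm_mult norm_power)
  finally have "\<bar>cos (pi * of_int h / real n)\<bar> ^ k / 4 \<le> (\<Sum>s\<in>?S. \<bar>f s - dic_U n s\<bar>) / 2"
    by simp
  moreover have "tv_dist ?S f (dic_U n) = (\<Sum>s\<in>?S. \<bar>f s - dic_U n s\<bar>) / 2"
    unfolding f_def using conv_power_total[OF assms(1)] dic_U_total[OF assms(1)]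
    by (intro tv_dist_eq_half_L1 finite_carrier_Dic) simp
  ultimately show ?thesis
    by (simp add: f_def)
qed

section \<open>Trigonometric estimates\<close>

text \<open>Doubling permutes the residues modulo the odd number \<open>2 r + 1\<close>. On representatives up to sign
  it acts on \<open>{1..r}\<close> by the map \<open>\<sigma>\<close> below.\<close>

lemma sum_doubled_cos:
  fixes r k :: nat
  defines "n \<equiv> 2 * r + 1"
  shows "(\<Sum>l\<in>{1..<n}. cos (2 * pi * real l / real n) ^ (2 * k))
    = 2 * (\<Sum>l\<in>{1..r}. cos (pi * real l / real n) ^ (2 * k))"
proof -
  define g where "g l = cos (pi * real l / real n) ^ (2 * k)" for l
  define \<sigma> where "\<sigma> l = (if 2 * l \<le> r then 2 * l else n - 2 * l)" for l
  \<comment> \<open>The even exponent absorbs the sign change of the cosine.\<close>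
  have g_reflect: "g (n - l) = g l" if "l \<le> n" for l
  proof -
    have "pi * real (n - l) / real n = pi - pi * real l / real n"
      using that by (simp add: n_def field_simps)
    then show ?thesis
      by (simp add: g_def)
  qed
  have g_double: "g (2 * (n - l)) = g (2 * l)" if "l \<le> n" for l
  proof -
    have "pi * real (2 * (n - l)) / real n = 2 * pi - pi * real (2 * l) / real n"
      using that by (simp add: n_def field_simps)
    then show ?thesis
      by (simp add: g_def cos_diff)
  qed
  \<comment> \<open>The first branch takes even values and the second odd ones, as \<open>n\<close>
    is odd, so the branches cannot collide.\<close>
  have "inj_on \<sigma> {1..r}"
    by (rule inj_onI) (auto simp: \<sigma>_def n_def split: if_splits; presburger)
  moreover have "\<sigma> ` {1..r} \<subseteq> {1..r}"
    by (auto simp: \<sigma>_def n_def)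
  ultimately have bij: "bij_betw \<sigma> {1..r} {1..r}"
    by (simp add: bij_betw_def endo_inj_surj)
  have half: "(\<Sum>l\<in>{1..r}. g (2 * l)) = (\<Sum>l\<in>{1..r}. g l)"
  proof -
    have "(\<Sum>l\<in>{1..r}. g (2 * l)) = (\<Sum>l\<in>{1..r}. g (\<sigma> l))"
      using g_reflect by (intro sum.cong) (auto simp: \<sigma>_def n_def)
    also have "\<dots> = (\<Sum>l\<in>{1..r}. g l)"
      by (rule sum.reindex_bij_betw[OF bij])
    finally show ?thesis .
  qed
  have "(\<Sum>l\<in>{1..<n}. g (2 * l)) = (\<Sum>l\<in>{1..r}. g (2 * l)) + (\<Sum>l\<in>{r + 1..<n}. g (2 * l))"
    using sum.atLeastLessThan_concat[of 1 "r + 1" n "\<lambda>l. g (2 * l)"]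
    by (simp add: n_def atLeastLessThanSuc_atLeastAtMost)
  also have "(\<Sum>l\<in>{r + 1..<n}. g (2 * l)) = (\<Sum>l\<in>{1..r}. g (2 * l))"
    by (rule sum.reindex_bij_witness[where i = "\<lambda>l. n - l" and j = "\<lambda>l. n - l"])
      (use g_double in \<open>auto simp: n_def\<close>)
  finally show ?thesis
    using half by (simp add: g_def mult_ac)
qed

text \<open>The product \<open>cos x * exp (x\<^sup>2 / 2)\<close> starts at \<open>1\<close> and
  does not increase: its derivative has the sign of \<open>y * cos y - sin y\<close>, which vanishes
  at \<open>0\<close> and has derivative \<open>- (y * sin y)\<close>.\<close>

lemma cos_le_exp_square:
  fixes x :: real
  assumes "0 \<le> x" "x \<le> pi / 2"
  shows "cos x \<le> exp (- x\<^sup>2 / 2)"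
proof -
  have "cos x * exp (x\<^sup>2 / 2) \<le> cos 0 * exp (0\<^sup>2 / 2)"
  proof (rule DERIV_nonpos_imp_nonincreasing[OF assms(1)])
    fix y assume y: "0 \<le> y" "y \<le> x"
    have "((\<lambda>y. cos y * exp (y\<^sup>2 / 2)) has_real_derivative
        (y * cos y - sin y) * exp (y\<^sup>2 / 2)) (at y)"
      by (auto intro!: derivative_eq_intros simp: algebra_simps)
    moreover have "y * cos y \<le> sin y"
    proof -
      have "0 * cos 0 - sin 0 \<ge> y * cos y - sin y"
      proof (rule DERIV_nonpos_imp_nonincreasing[OF y(1)])
        fix z assume z: "0 \<le> z" "z \<le> y"
        have "((\<lambda>z. z * cos z - sin z) has_real_derivative - (z * sin z)) (at z)"
          by (auto intro!: derivative_eq_intros)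
        moreover have "z * sin z \<ge> 0"
          using z y assms(2) pi_gt_zero by (intro mult_nonneg_nonneg sin_ge_zero) linarith+
        ultimately show "\<exists>D. ((\<lambda>z. z * cos z - sin z) has_real_derivative D) (at z) \<and> D \<le> 0"
          by (intro exI conjI) auto
      qed
      then show ?thesis
        by simp
    qed
    ultimately show "\<exists>D. ((\<lambda>y. cos y * exp (y\<^sup>2 / 2)) has_real_derivative D) (at y) \<and> D \<le> 0"
      by (intro exI conjI) (auto intro: mult_nonpos_nonneg)
  qed
  then show ?thesis
    by (simp add: exp_minus field_simps)
qed

text \<open>The Gaussian bound dominates the terms by \<open>q ^ l\<^sup>2\<close>, which are then
  compared with a geometric series of ratio \<open>q ^ 3\<close>.\<close>

lemma sum_cos_powers_le:
  fixes r k :: nat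
  defines "n \<equiv> 2 * r + 1"
  defines "q \<equiv> exp (- (pi\<^sup>2 * real k / (real n)\<^sup>2))"
  assumes "k \<ge> 1"
  shows "(\<Sum>l\<in>{1..r}. cos (pi * real l / real n) ^ (2 * k)) \<le> q / (1 - q ^ 3)"
proof -
  have q: "0 < q" "q < 1"
    using assms(3) by (simp_all add: q_def n_def)
  then have q3: "0 < q ^ 3" "q ^ 3 < 1"
    by (simp_all add: power_less_one_iff)
  have term_le: "cos (pi * real (Suc i) / real n) ^ (2 * k) \<le> q * (q ^ 3) ^ i" if "i < r" for i
  proof -
    define x where "x = pi * real (Suc i) / real n"
    have "2 * real (Suc i) \<le> real n"
      using that by (simp add: n_def)
    then have "pi * (2 * real (Suc i)) \<le> pi * real n"
      by (intro mult_left_mono) simp_all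
    then have x: "0 \<le> x" "x \<le> pi / 2"
      by (simp_all add: x_def n_def divide_le_eq mult_ac)
    have "cos x ^ (2 * k) \<le> exp (- x\<^sup>2 / 2) ^ (2 * k)"
      using x by (intro power_mono cos_le_exp_square cos_ge_zero) simp_all
    also have "\<dots> = q ^ (Suc i)\<^sup>2"
      unfolding q_def x_def exp_of_nat_mult[symmetric]
      by (rule arg_cong[where f = exp]) (simp add: power_divide power_mult_distrib del: of_nat_Suc)
    \<comment> \<open>With \<open>l = i + 1\<close> this uses
      \<open>l\<^sup>2 \<ge> 1 + 3 * (l - 1)\<close>, an equality for \<open>l = 1\<close> and
      \<open>l = 2\<close>.\<close>
    also have "\<dots> \<le> q ^ (1 + 3 * i)"
    proof (rule power_decreasing)
      have "i * i \<ge> i"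
        by (cases i) simp_all
      then show "1 + 3 * i \<le> (Suc i)\<^sup>2"
        by (simp add: power2_eq_square)
    qed (use q in simp_all)
    finally show ?thesis
      by (simp add: x_def power_mult)
  qed
  have "(\<Sum>l\<in>{1..r}. cos (pi * real l / real n) ^ (2 * k))
      = (\<Sum>i<r. cos (pi * real (Suc i) / real n) ^ (2 * k))"
    by (simp only: One_nat_def sum.atLeast1_atMost_eq)
  also have "\<dots> \<le> (\<Sum>i<r. q * (q ^ 3) ^ i)"
    using term_le by (intro sum_mono) simp
  also have "\<dots> = q * ((1 - (q ^ 3) ^ r) / (1 - q ^ 3))"
    using q3 by (simp add: sum_gp_strict flip: sum_distrib_left del: power_mult)
  also have "\<dots> \<le> q * (1 / (1 - q ^ 3))"
    using q q3 by (intro mult_left_mono divide_right_mono) simp_all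
  finally show ?thesis
    by simp
qed

text \<open>Since \<open>ln (cos y)\<close> has derivative \<open>- tan y\<close>, it suffices to
  integrate a polynomial upper bound for \<open>tan\<close>. That bound is bootstrapped from
  \<open>tan' = 1 + tan\<^sup>2\<close>: each estimate, squared and integrated, yields a sharper
  one.\<close>

lemma exp_le_cos:
  fixes x :: real
  assumes "0 \<le> x" "x \<le> 1 / 2"
  shows "exp (- x\<^sup>2 / 2 - x ^ 4 / 12 - 17 * x ^ 5 / 120) \<le> cos x"
proof -
  have cos_pos: "0 < cos y" if "0 \<le> y" "y \<le> x" for y
    using that assms pi_gt3 by (intro cos_gt_zero_pi) linarith+
  have tan_deriv: "(tan has_real_derivative 1 + (tan y)\<^sup>2) (at y)" if "0 \<le> y" "y \<le> x" for y
    using DERIV_tan[of y] cos_pos[OF that] by (simp add: tan_sec inverse_eq_divide power_divide)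
  have tan_nonneg: "0 \<le> tan y" if "0 \<le> y" "y \<le> x" for y
    using that assms pi_gt3 tan_pos_pi2_le[of y] by linarith
  have tan_bound: "tan y \<le> f y"
    if y: "0 \<le> y" "y \<le> x" and "f 0 = 0"
      and df: "\<And>z. (f has_real_derivative 1 + f' z) (at z)"
      and le: "\<And>z. 0 \<le> z \<Longrightarrow> z \<le> x \<Longrightarrow> (tan z)\<^sup>2 \<le> f' z" for y f f'
  proof -
    have "f 0 - tan 0 \<le> f y - tan y"
    proof (rule DERIV_nonneg_imp_nondecreasing[OF y(1)])
      fix z assume "0 \<le> z" "z \<le> y"
      then show "\<exists>D. ((\<lambda>z. f z - tan z) has_real_derivative D) (at z) \<and> 0 \<le> D"
        using y(2) le[of z] df[of z] tan_deriv[of z]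
        by (intro exI[of _ "(1 + f' z) - (1 + (tan z)\<^sup>2)"] conjI DERIV_diff) auto
    qed
    then show ?thesis
      using that(3) by simp
  qed
  have tan1: "tan y \<le> 2 * y" if "0 \<le> y" "y \<le> x" for y
  proof (rule tan_bound[where f' = "\<lambda>_. 1", OF that])
    \<comment> \<open>Here \<open>z \<le> 1 / 2 < pi / 4\<close> and
      \<open>tan (pi / 4) = 1\<close>.\<close>
    show "(tan z)\<^sup>2 \<le> 1" if "0 \<le> z" "z \<le> x" for z
      using tan_mono_le[of z "pi / 4"] tan_nonneg[OF that] that assms pi_gt3
      by (simp add: tan_45 power_le_one)
  qed (auto intro!: derivative_eq_intros)
  have tan2: "tan y \<le> y + y\<^sup>2" if "0 \<le> y" "y \<le> x" for y
  proof (rule tan_bound[where f' = "\<lambda>z. 2 * z", OF that])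
    fix z assume z: "0 \<le> z" "z \<le> x"
    have "(tan z)\<^sup>2 \<le> (2 * z)\<^sup>2"
      using tan1[OF z] tan_nonneg[OF z] by (intro power_mono)
    also have "\<dots> \<le> 2 * z"
      using z assms mult_left_mono[of "2 * z" 1 "2 * z"] by (simp add: power2_eq_square)
    finally show "(tan z)\<^sup>2 \<le> 2 * z" .
  qed (auto intro!: derivative_eq_intros)
  have tan3: "tan y \<le> y + y ^ 3 / 3 + 17 * y ^ 4 / 24" if "0 \<le> y" "y \<le> x" for y
  proof (rule tan_bound[where f' = "\<lambda>z. z\<^sup>2 + 17 * z ^ 3 / 6", OF that])
    fix z assume z: "0 \<le> z" "z \<le> x"
    have "(tan z)\<^sup>2 \<le> (z + z\<^sup>2)\<^sup>2"
      using tan2[OF z] tan_nonneg[OF z] by (intro power_mono)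
    also have "\<dots> = z\<^sup>2 + z ^ 3 * (2 + z)"
      by (simp add: power2_eq_square power3_eq_cube algebra_simps)
    \<comment> \<open>There is slack, as \<open>2 + z \<le> 5 / 2\<close>; the constant
      \<open>17 / 6\<close> becomes \<open>17 / 24\<close> and then \<open>17 / 120\<close> after
      two integrations.\<close>
    also have "\<dots> \<le> z\<^sup>2 + z ^ 3 * (17 / 6)"
      using z assms by (intro add_left_mono mult_left_mono) simp_all
    finally show "(tan z)\<^sup>2 \<le> z\<^sup>2 + 17 * z ^ 3 / 6"
      by simp
  qed (auto intro!: derivative_eq_intros)
  have "ln (cos 0) + 0\<^sup>2 / 2 + 0 ^ 4 / 12 + 17 * 0 ^ 5 / 120
      \<le> ln (cos x) + x\<^sup>2 / 2 + x ^ 4 / 12 + 17 * x ^ 5 / 120"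
  proof (rule DERIV_nonneg_imp_nondecreasing[OF assms(1)])
    fix y assume y: "0 \<le> y" "y \<le> x"
    have "((\<lambda>y. ln (cos y) + y\<^sup>2 / 2 + y ^ 4 / 12 + 17 * y ^ 5 / 120) has_real_derivative
        - tan y + y + y ^ 3 / 3 + 17 * y ^ 4 / 24) (at y)"
      using cos_pos[OF y] by (auto intro!: derivative_eq_intros simp: tan_def)
    then show "\<exists>D. ((\<lambda>y. ln (cos y) + y\<^sup>2 / 2 + y ^ 4 / 12 + 17 * y ^ 5 / 120)
        has_real_derivative D) (at y) \<and> 0 \<le> D"
      using tan3[OF y] by (intro exI conjI) auto
  qed
  then have "- x\<^sup>2 / 2 - x ^ 4 / 12 - 17 * x ^ 5 / 120 \<le> ln (cos x)"
    by simp
  then show ?thesis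
    using cos_pos[of x] assms(1) by (simp add: ln_ge_iff)
qed

section \<open>Combination of the total variation bounds with the cosine estimates\<close>

theorem theorem3p3:
  shows
    "(\<forall>n k :: nat. 1 \<le> n \<and> odd n \<and> 2 \<le> k \<longrightarrow>
        (tv_dist (carrier (Dic n)) (conv_power (Dic n) dic_Q k) (dic_U n))\<^sup>2
          \<le> real n * 2 powr (- real k - 1)
             + exp (- (pi^2 * (real k - 1) / (real n)^2))
               / (2 * (1 - exp (- (3 * pi^2 * (real k - 1) / (real n)^2)))))
     \<and>
     (\<forall>n k :: nat. 7 \<le> n \<and> odd n \<and> 1 \<le> k \<longrightarrow>
        1 / 4 * exp (- (pi^2 * real k / (2 * (real n)^2))
                     - pi^4 * real k / (12 * (real n)^4)
                     - 17 * pi^5 * real k / (120 * (real n)^5))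
          \<le> tv_dist (carrier (Dic n)) (conv_power (Dic n) dic_Q k) (dic_U n))"
proof (intro conjI allI impI; elim conjE)
  fix n k :: nat
  assume n: "1 \<le> n" "odd n" and k: "2 \<le> k"
  obtain r where r: "n = 2 * r + 1"
    using n(2) by (rule oddE)
  obtain m where m: "k = Suc m" "m \<ge> 1"
    using k by (cases k) simp_all
  define q where "q = exp (- (pi\<^sup>2 * real m / (real n)\<^sup>2))"
  have q3: "q ^ 3 = exp (- (3 * pi\<^sup>2 * real m / (real n)\<^sup>2))"
    by (simp add: q_def flip: exp_of_nat_mult)
  have "(\<Sum>l\<in>{1..<n}. cos (2 * pi * real l / real n) ^ (2 * m)) / 4
      = (\<Sum>l\<in>{1..r}. cos (pi * real l / real n) ^ (2 * m)) / 2"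
    unfolding r sum_doubled_cos by simp
  also have "\<dots> \<le> q / (1 - q ^ 3) / 2"
    using sum_cos_powers_le[OF m(2), of r] unfolding q_def r by (intro divide_right_mono) simp_all
  also have "\<dots> = q / (2 * (1 - q ^ 3))"
    by (simp only: divide_divide_eq_left mult.commute)
  finally have "(\<Sum>l\<in>{1..<n}. cos (2 * pi * real l / real n) ^ (2 * m)) / 4 \<le> q / (2 * (1 - q ^ 3))" .
  moreover have "2 powr (- real k - 1) = 1 / 2 ^ (m + 2)"
  proof -
    have "- real k - 1 = - real (m + 2)"
      by (simp add: m)
    then show ?thesis
      by (simp only: powr_minus powr_realpow inverse_eq_divide zero_less_numeral)
  qed
  moreover have "real k - 1 = real m"
    by (simp add: m)
  ultimately show "(tv_dist (carrier (Dic n)) (conv_power (Dic n) dic_Q k) (dic_U n))\<^sup>2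
          \<le> real n * 2 powr (- real k - 1)
             + exp (- (pi^2 * (real k - 1) / (real n)^2))
               / (2 * (1 - exp (- (3 * pi^2 * (real k - 1) / (real n)^2))))"
    using tv_dist_upper[OF n(1), of m]
    by (simp only: m(1) q3[symmetric] q_def[symmetric] times_divide_eq_right mult_1_right)
next
  fix n k :: nat
  assume n: "7 \<le> n" "odd n" and k: "1 \<le> k"
  obtain m where m: "k = Suc m"
    using k by (cases k) simp_all
  define x where "x = pi / real n"
  \<comment> \<open>From \<open>pi < 7 / 2\<close> and \<open>n \<ge> 7\<close>, the angle lies in
    the range of \<open>exp_le_cos\<close>.\<close>
  have "pi / real n \<le> (7 / 2) / 7"
    using n(1) pi_less_4 pi_approx by (intro frac_le) simp_all
  then have x: "0 \<le> x" "x \<le> 1 / 2"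
    by (simp_all add: x_def)
  have cos_x: "0 \<le> cos x"
    using x pi_gt3 by (intro cos_ge_zero) simp_all
  have "exp (- (pi^2 * real k / (2 * (real n)^2)) - pi^4 * real k / (12 * (real n)^4)
      - 17 * pi^5 * real k / (120 * (real n)^5))
    = exp (- x\<^sup>2 / 2 - x ^ 4 / 12 - 17 * x ^ 5 / 120) ^ k"
    unfolding exp_of_nat_mult[symmetric] x_def
    by (rule arg_cong[where f = exp]) (simp add: power_divide field_simps)
  also have "\<dots> \<le> cos x ^ k"
    using exp_le_cos[OF x] by (intro power_mono) simp_all
  \<comment> \<open>The coefficient after \<open>k = Suc m\<close> steps carries \<open>m\<close>
    powers of the cosine, so one factor \<open>cos x \<le> 1\<close> is given away.\<close>
  also have "\<dots> \<le> \<bar>cos x\<bar> ^ m"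
    using cos_x power_decreasing[of m k "cos x"] by (simp add: m)
  \<comment> \<open>The frequency \<open>n - 1\<close> is even because \<open>n\<close> is odd, and
    its angle is \<open>pi - x\<close>.\<close>
  also have "\<bar>cos x\<bar> = \<bar>cos (pi * of_int (int n - 1) / real n)\<bar>"
  proof -
    have "pi * of_int (int n - 1) / real n = pi - x"
      using n(1) by (simp add: x_def field_simps)
    then show ?thesis
      by (simp only: cos_pi_minus abs_minus_cancel)
  qed
  also have "\<dots> ^ m / 4 \<le> tv_dist (carrier (Dic n)) (conv_power (Dic n) dic_Q (Suc m)) (dic_U n)"
    using n zdvd_imp_le[of "2 * int n" "int n - 1"] by (intro tv_dist_lower) auto
  finally show "1 / 4 * exp (- (pi^2 * real k / (2 * (real n)^2))
                     - pi^4 * real k / (12 * (real n)^4)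
                     - 17 * pi^5 * real k / (120 * (real n)^5))
          \<le> tv_dist (carrier (Dic n)) (conv_power (Dic n) dic_Q k) (dic_U n)"
    by (simp add: m)
qed

end
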